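(* Let $p$ be a prime. For any positive integer $t$ and any pattern $\alpha=(a_1, \ldots, a_k)\in\mathbb F_p^{k}$ with $k\ge 2t$, if $a_t\ne a_{t+1}=a_{t+2}=\cdots =a_k$, then $f_\alpha(p, n) =\Theta(n^{1/t})$. Moreover, if $a_t-a_{t+1}=1$ (in $\mathbb F_p$), then $f_\alpha(p, n) \sim (t!\, n)^{1/t}$.
   Context: Let $[n]=\{1,\ldots,n\}$. For a prime $p$ and $\alpha=(a_1,\ldots,a_k)\in\mathbb F_p^k$, a family $\mathcal F\subset 2^{[n]}$ is $\alpha$-intersecting modulo $p$ if for each $i\in[k]$ and any $i$ distinct members $F_1,\ldots,F_i\in\mathcal F$ one has $|F_1\cap\cdots\cap F_i|\equiv a_i\pmod p$. Let $f_\alpha(p,n)$ be the maximum size of an $\alpha$-intersecting family $\mathcal F\subset 2^{[n]}$ modulo $p$. Asymptotics are as $n\to\infty$ with $p,k,\alpha$ fixed: $f=O(g)$ means there is a constant $c>0$ with $f(n)\le c\,g(n)$ for all sufficiently large $n$; $f=\Theta(g)$ means $f=O(g)$ and $g=O(f)$; $f\sim g$ means $\lim_{n\to\infty}f(n)/g(n)=1$. *)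

theory Defs
  imports
    Complex_Main
    "HOL-Library.Landau_Symbols"
    "HOL-Computational_Algebra.Primes"
    "HOL-Number_Theory.Cong"
begin

text \<open>
  A pattern \<open>(a\<^sub>1, \<dots>, a\<^sub>k)\<close> over the field with \<open>p\<close> elements is given by integer representatives
  \<open>a 1, \<dots>, a k\<close>, and equality in the field is congruence modulo \<open>p\<close>. Values of \<open>a\<close> outside
  \<open>{1..k}\<close> are irrelevant. Any \<open>i\<close> distinct members of a family are the elements of a subfamily of
  cardinality \<open>i\<close>; as \<open>i \<ge> 1\<close>, such a subfamily is finite and nonempty.
\<close>

definition alpha_intersecting :: "nat \<Rightarrow> nat \<Rightarrow> (nat \<Rightarrow> int) \<Rightarrow> nat set set \<Rightarrow> bool" where
  "alpha_intersecting p k a F \<longleftrightarrow>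
     (\<forall>i\<in>{1..k}. \<forall>G. G \<subseteq> F \<and> card G = i \<longrightarrow> [int (card (\<Inter>G)) = a i] (mod int p))"

definition alpha_families :: "nat \<Rightarrow> nat \<Rightarrow> (nat \<Rightarrow> int) \<Rightarrow> nat \<Rightarrow> nat set set set" where
  "alpha_families p k a n = {F. F \<subseteq> Pow {1..n} \<and> alpha_intersecting p k a F}"

definition max_alpha_family :: "nat \<Rightarrow> nat \<Rightarrow> (nat \<Rightarrow> int) \<Rightarrow> nat \<Rightarrow> nat" where
  "max_alpha_family p k a n = Max (card ` alpha_families p k a n)"

text \<open>The maximum is taken over a finite nonempty set.\<close>

lemma finite_alpha_families: "finite (alpha_families p k a n)"
  unfolding alpha_families_def by (rule finite_subset[of _ "Pow (Pow {1..n})"]) auto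

lemma empty_in_alpha_families: "{} \<in> alpha_families p k a n"
  by (auto simp: alpha_families_def alpha_intersecting_def)

end

theory Submission imports Defs "HOL-Library.FuncSet" "HOL-Real_Asymp.Real_Asymp" begin

text \<open>
  Upper bound: the intersections of the \<open>t\<close>-subsets of a family of size \<open>m\<close> have sizes congruent to
  \<open>a t\<close>, and two distinct ones meet in a set of size congruent to \<open>a (t + 1)\<close>, since the union of two
  distinct \<open>t\<close>-subsets has between \<open>t + 1\<close> and \<open>2 t \<le> k\<close> members. Their characteristic vectors, with
  a coordinate 1 appended, are therefore orthogonal and non-isotropic for a bilinear form in dimension
  \<open>n + 1\<close>, so that \<open>m choose t \<le> n + 1\<close>.

  Lower bound: to each \<open>S \<subseteq> {..<m}\<close> with at most \<open>t\<close> elements assign fewer than \<open>p\<close> points which belong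
  to exactly the members indexed by \<open>S\<close>, and add \<open>a (t + 1) mod p\<close> points common to all members. The
  intersection conditions form a triangular system for these numbers, solved downwards from the
  \<open>t\<close>-subsets, each of which gets \<open>w = (a t - a (t + 1)) mod p\<close> points. This uses
  \<open>w * (m choose t) + O(m ^ (t - 1))\<close> points.
\<close>

section \<open>Linear independence modulo \<open>p\<close> and the upper bound\<close>

text \<open>The form is the standard product on \<open>X\<close> minus \<open>b\<close> times the
  product of the appended coordinates. Its Gram matrix on the vectors of the \<open>A i\<close> is
  \<open>a - b\<close> times the identity, hence invertible modulo \<open>p\<close>.\<close>

lemma near_orthogonal_sets_bound:
  fixes A :: "'i \<Rightarrow> 'a set" and a b :: int
  assumes p: "prime p" and "finite I" "finite X" and sub: "\<And>i. i \<in> I \<Longrightarrow> A i \<subseteq> X"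
    and diag: "\<And>i. i \<in> I \<Longrightarrow> [int (card (A i)) = a] (mod int p)"
    and off: "\<And>i j. i \<in> I \<Longrightarrow> j \<in> I \<Longrightarrow> i \<noteq> j \<Longrightarrow> [int (card (A i \<inter> A j)) = b] (mod int p)"
    and ab: "\<not> [a = b] (mod int p)"
  shows "card I \<le> card X + 1"
proof -
  define D where "D = (I \<rightarrow>\<^sub>E {0..<int p})"
  define R where "R = (insert None (Some ` X) \<rightarrow>\<^sub>E {0..<int p})"
  \<comment> \<open>\<open>\<Phi> c\<close> is the combination of the vectors with coefficients
    \<open>c\<close>, reduced modulo \<open>p\<close>; \<open>None\<close> is the appended
    coordinate.\<close>
  define \<Phi> where "\<Phi> c = restrict (\<lambda>z. case z of None \<Rightarrow> (\<Sum>i\<in>I. c i) mod int p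
      | Some x \<Rightarrow> (\<Sum>i\<in>I. c i * of_bool (x \<in> A i)) mod int p) (insert None (Some ` X))"
    for c :: "'i \<Rightarrow> int"
  have p1: "p > 1" using p prime_gt_1_nat by blast
  \<comment> \<open>Pairing the combination with the vector of \<open>A j\<close> leaves only the
    term \<open>i = j\<close>.\<close>
  have key: "[(\<Sum>x\<in>A j. \<Sum>i\<in>I. c i * of_bool (x \<in> A i)) - b * (\<Sum>i\<in>I. c i) = (a - b) * c j] (mod int p)"
    if j: "j \<in> I" for c :: "'i \<Rightarrow> int" and j
  proof -
    have fin: "finite (A j)" using sub[OF j] \<open>finite X\<close> finite_subset by blast
    have "(\<Sum>x\<in>A j. \<Sum>i\<in>I. c i * of_bool (x \<in> A i)) = (\<Sum>i\<in>I. c i * int (card (A j \<inter> A i)))"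
      by (subst sum.swap) (simp add: fin flip: sum_distrib_left)
    hence "(\<Sum>x\<in>A j. \<Sum>i\<in>I. c i * of_bool (x \<in> A i)) - b * (\<Sum>i\<in>I. c i)
        = (\<Sum>i\<in>I. c i * (int (card (A j \<inter> A i)) - b))"
      by (simp add: algebra_simps sum_subtractf sum_distrib_left)
    also have "[\<dots> = (\<Sum>i\<in>I. if i = j then (a - b) * c j else 0)] (mod int p)"
    proof (rule cong_sum)
      fix i assume i: "i \<in> I"
      show "[c i * (int (card (A j \<inter> A i)) - b) = (if i = j then (a - b) * c j else 0)] (mod int p)"
      proof (cases "i = j")
        case True
        then show ?thesis using cong_scalar_left[OF cong_diff[OF diag[OF j] cong_refl], of "c j" b]
          by (simp add: mult.commute)
      next
        case False
        then show ?thesis using cong_scalar_left[OF cong_diff[OF off[OF j i] cong_refl], of "c i" b]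
          by simp
      qed
    qed
    also have "(\<Sum>i\<in>I. if i = j then (a - b) * c j else 0) = (a - b) * c j"
      using j \<open>finite I\<close> by simp
    finally show ?thesis .
  qed
  \<comment> \<open>Counting the values of \<open>\<Phi>\<close> modulo \<open>p\<close> replaces a rank argument: by \<open>key\<close>, \<open>\<Phi> c\<close> determines \<open>c\<close>.\<close>
  have "inj_on \<Phi> D"
  proof (rule inj_onI)
    fix c d assume c: "c \<in> D" and d: "d \<in> D" and eq: "\<Phi> c = \<Phi> d"
    have N: "[(\<Sum>i\<in>I. c i) = (\<Sum>i\<in>I. d i)] (mod int p)"
      unfolding unique_euclidean_semiring_class.cong_def using fun_cong[OF eq[unfolded \<Phi>_def], of None] by (simp only: restrict_apply insertI1 if_True option.case)
    have S: "[(\<Sum>i\<in>I. c i * of_bool (x \<in> A i)) = (\<Sum>i\<in>I. d i * of_bool (x \<in> A i))] (mod int p)"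
      if "x \<in> X" for x
      using fun_cong[OF eq, of "Some x"] that by (simp add: \<Phi>_def unique_euclidean_semiring_class.cong_def)
    show "c = d"
    proof (rule PiE_ext[OF c[unfolded D_def] d[unfolded D_def]])
      fix j assume j: "j \<in> I"
      have "[(\<Sum>x\<in>A j. \<Sum>i\<in>I. c i * of_bool (x \<in> A i)) - b * (\<Sum>i\<in>I. c i)
           = (\<Sum>x\<in>A j. \<Sum>i\<in>I. d i * of_bool (x \<in> A i)) - b * (\<Sum>i\<in>I. d i)] (mod int p)"
        using sub[OF j] by (intro cong_diff[OF cong_sum cong_scalar_left[OF N]] S) blast
      hence "[(a - b) * c j = (a - b) * d j] (mod int p)"
        using key[OF j] by (meson cong_sym cong_trans)
      moreover have "coprime (a - b) (int p)"
        using p ab by (metis cong_iff_dvd_diff coprime_commute prime_imp_coprime prime_nat_int_transfer)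
      ultimately have "[c j = d j] (mod int p)"
        by (simp add: cong_mult_lcancel)
      moreover have "c j \<in> {0..<int p}" "d j \<in> {0..<int p}"
        using c d j unfolding D_def by auto
      ultimately show "c j = d j" by (auto simp: unique_euclidean_semiring_class.cong_def)
    qed
  qed
  moreover have "\<Phi> ` D \<subseteq> R"
    unfolding \<Phi>_def R_def image_subset_iff restrict_PiE_iff using p1
    by (auto split: option.split)
  moreover have "finite R" unfolding R_def by (intro finite_PiE) (auto simp: \<open>finite X\<close>)
  ultimately have "card D \<le> card R" by (rule card_inj_on_le)
  moreover have "card D = p ^ card I" by (simp add: D_def card_PiE \<open>finite I\<close>)
  moreover have "card R = p ^ (card X + 1)"
    unfolding R_def using \<open>finite X\<close> by (subst card_PiE) (auto simp: card_image)
  ultimately show ?thesis using p1 power_le_imp_le_exp by metis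
qed

lemma alpha_intersecting_choose_bound:
  assumes p: "prime p" and t: "t \<ge> 1" and k: "k \<ge> 2 * t"
    and at: "\<not> [a t = a (t + 1)] (mod int p)"
    and tail: "\<forall>i\<in>{t+1..k}. [a i = a (t + 1)] (mod int p)"
    and F: "F \<in> alpha_families p k a n"
  shows "card F choose t \<le> n + 1"
proof -
  define I where "I = {S. S \<subseteq> F \<and> card S = t}"
  have FP: "F \<subseteq> Pow {1..n}" and al: "alpha_intersecting p k a F"
    using F by (auto simp: alpha_families_def)
  have finF: "finite F" using FP by (rule finite_subset) simp
  have inter: "[int (card (\<Inter>G)) = a (card G)] (mod int p)" if "G \<subseteq> F" "card G \<in> {1..k}" for G
    using al that unfolding alpha_intersecting_def by blast
  have "card I \<le> card {1..n} + 1"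
  proof (rule near_orthogonal_sets_bound[OF p, of I _ "\<lambda>S. \<Inter>S" "a t" "a (t+1)"])
    show "finite I" by (rule finite_subset[of _ "Pow F"]) (auto simp: I_def finF)
    fix S assume S: "S \<in> I"
    \<comment> \<open>\<open>\<Inter>{}\<close> would be the whole type; \<open>t \<ge> 1\<close>
      excludes this.\<close>
    have "S \<noteq> {}" using S t by (auto simp: I_def)
    thus "\<Inter>S \<subseteq> {1..n}" using S FP by (auto simp: I_def)
    show "[int (card (\<Inter>S)) = a t] (mod int p)"
      using inter[of S] S t k by (auto simp: I_def)
    fix T assume T: "T \<in> I" "S \<noteq> T"
    have fin: "finite S" "finite T" using S T finF by (auto simp: I_def intro: finite_subset)
    have le: "card (S \<union> T) \<le> 2 * t" using card_Un_le[of S T] S T by (simp add: I_def)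
    have "\<not> T \<subseteq> S" using card_subset_eq[OF fin(1), of T] S T by (auto simp: I_def)
    hence "S \<subset> S \<union> T" by blast
    hence "card S < card (S \<union> T)" using fin by (intro psubset_card_mono) auto
    hence c: "card (S \<union> T) \<in> {t+1..k}" using S le k by (simp add: I_def)
    have "[int (card (\<Inter>(S \<union> T))) = a (card (S \<union> T))] (mod int p)"
      using inter[of "S \<union> T"] c S T by (auto simp: I_def)
    thus "[int (card (\<Inter>S \<inter> \<Inter>T)) = a (t + 1)] (mod int p)"
      using tail c by (metis Inter_Un_distrib cong_trans)
  qed (use at in auto)
  moreover have "card I = card F choose t" unfolding I_def by (rule n_subsets[OF finF])
  ultimately show ?thesis by simp
qed

section \<open>Construction of large families\<close>

text \<open>The sum for \<open>I\<close> contains \<open>W I\<close> once and otherwise only weights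
  of larger sets. Lowering \<open>s\<close> by one thus changes weights only on sets of size
  \<open>s\<close>, which leaves the congruences for larger \<open>I\<close> intact. At
  \<open>s = Suc t\<close> there is no condition and zero weights serve.\<close>

lemma exists_weights_mod:
  fixes d :: "nat \<Rightarrow> int"
  assumes V: "finite V" and p: "p > 0" and st: "s \<le> Suc t"
  shows "\<exists>W. (\<forall>S. W S < p) \<and> (\<forall>I. I \<subseteq> V \<and> card I \<in> {s..t} \<longrightarrow>
      [int (\<Sum>S | I \<subseteq> S \<and> S \<subseteq> V \<and> card S \<le> t. W S) = d (card I)] (mod int p))"
  using st
proof (induction s rule: inc_induct)
  case base
  show ?case using p by (intro exI[of _ "\<lambda>_. 0"]) auto
next
  case (step s)
  then obtain W where W: "\<And>S. W S < p"
    and sums: "\<And>I. I \<subseteq> V \<Longrightarrow> card I \<in> {Suc s..t} \<Longrightarrow>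
      [int (\<Sum>S | I \<subseteq> S \<and> S \<subseteq> V \<and> card S \<le> t. W S) = d (card I)] (mod int p)"
    by blast
  define r where "r I = int (\<Sum>S | I \<subset> S \<and> S \<subseteq> V \<and> card S \<le> t. W S)" for I
  define W' where "W' S = (if card S = s then nat ((d s - r S) mod int p) else W S)" for S
  show ?case
  proof (intro exI[of _ W'] conjI allI impI)
    fix S show "W' S < p" using W[of S] p by (simp add: W'_def nat_less_iff)
  next
    fix I assume I: "I \<subseteq> V \<and> card I \<in> {s..t}"
    have finI: "finite I" using I V finite_subset by blast
    have bigger: "card I < card S" if "I \<subset> S" "S \<subseteq> V" for S
      using that V by (meson finite_subset psubset_card_mono)
    have fin: "finite {S. I \<subset> S \<and> S \<subseteq> V \<and> card S \<le> t}"
      by (rule finite_subset[of _ "Pow V"]) (use V in auto)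
    have split: "{S. I \<subseteq> S \<and> S \<subseteq> V \<and> card S \<le> t} = insert I {S. I \<subset> S \<and> S \<subseteq> V \<and> card S \<le> t}"
      using I by auto
    have sm: "(\<Sum>S | I \<subset> S \<and> S \<subseteq> V \<and> card S \<le> t. W' S) = (\<Sum>S | I \<subset> S \<and> S \<subseteq> V \<and> card S \<le> t. W S)"
    proof (rule sum.cong)
      fix S assume "S \<in> {S. I \<subset> S \<and> S \<subseteq> V \<and> card S \<le> t}"
      thus "W' S = W S" using I bigger[of S] by (simp add: W'_def)
    qed simp
    have eq: "int (\<Sum>S | I \<subseteq> S \<and> S \<subseteq> V \<and> card S \<le> t. W' S) = int (W' I) + r I"
      unfolding split r_def by (subst sum.insert) (simp_all add: fin sm)
    show "[int (\<Sum>S | I \<subseteq> S \<and> S \<subseteq> V \<and> card S \<le> t. W' S) = d (card I)] (mod int p)"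
    proof (cases "card I = s")
      case True
      then have "int (W' I) = (d s - r I) mod int p" using p by (simp add: W'_def)
      then show ?thesis using True by (simp only: eq unique_euclidean_semiring_class.cong_def mod_add_left_eq diff_add_cancel)
    next
      case False
      have "int (W' I) + r I = int (\<Sum>S | I \<subseteq> S \<and> S \<subseteq> V \<and> card S \<le> t. W S)"
        unfolding split r_def using False by (subst sum.insert) (simp_all add: fin W'_def)
      then show ?thesis unfolding eq using sums[of I] I False by simp
    qed
  qed
qed

text \<open>\<open>U S\<close> is the prescribed size of a region of the Venn diagram; the
  intersection over \<open>I\<close> is the disjoint union of the regions with
  \<open>I \<subseteq> S\<close>.\<close>

lemma realize_intersection_weights:
  fixes U :: "'v set \<Rightarrow> nat"
  assumes V: "finite V" and n: "(\<Sum>S\<in>Pow V. U S) \<le> n"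
  obtains A :: "'v \<Rightarrow> nat set" where "\<And>v. v \<in> V \<Longrightarrow> A v \<subseteq> {1..n}"
    and "\<And>I. I \<subseteq> V \<Longrightarrow> I \<noteq> {} \<Longrightarrow> card (\<Inter>v\<in>I. A v) = (\<Sum>S | I \<subseteq> S \<and> S \<subseteq> V. U S)"
proof -
  \<comment> \<open>\<open>(S, r)\<close> is the \<open>r\<close>-th of the \<open>U S\<close> points that lie in \<open>A v\<close> exactly for \<open>v \<in> S\<close>.\<close>
  define P where "P = Sigma (Pow V) (\<lambda>S. {..<U S})"
  have finP: "finite P" unfolding P_def using V by auto
  have "card P \<le> card {1..n}" using n V by (simp add: P_def)
  then obtain g where g: "g ` P \<subseteq> {1..n}" "inj_on g P"
    using card_le_inj[OF finP] by blast
  define A where "A v = g ` {x\<in>P. v \<in> fst x}" for v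
  show ?thesis
  proof (rule that[of A])
    show "A v \<subseteq> {1..n}" if "v \<in> V" for v using g(1) by (auto simp: A_def)
  next
    fix I assume I: "I \<subseteq> V" "I \<noteq> {}"
    then obtain v0 where v0: "v0 \<in> I" by blast
    \<comment> \<open>Injectivity of \<open>g\<close> lets the image commute with a nonempty
      intersection.\<close>
    have "(\<Inter>v\<in>I. A v) = g ` (\<Inter>v\<in>I. {x\<in>P. v \<in> fst x})"
      unfolding A_def using v0 by (intro image_INT[OF g(2) _ v0, symmetric]) auto
    also have "(\<Inter>v\<in>I. {x\<in>P. v \<in> fst x}) = Sigma {S. I \<subseteq> S \<and> S \<subseteq> V} (\<lambda>S. {..<U S})"
      using I by (auto simp: P_def)
    finally have "card (\<Inter>v\<in>I. A v) = card (g ` Sigma {S. I \<subseteq> S \<and> S \<subseteq> V} (\<lambda>S. {..<U S}))"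
      by simp
    also have "\<dots> = card (Sigma {S. I \<subseteq> S \<and> S \<subseteq> V} (\<lambda>S. {..<U S}))"
      by (intro card_image inj_on_subset[OF g(2)]) (auto simp: P_def)
    also have "\<dots> = (\<Sum>S | I \<subseteq> S \<and> S \<subseteq> V. U S)"
      using V by (subst card_SigmaI) auto
    finally show "card (\<Inter>v\<in>I. A v) = (\<Sum>S | I \<subseteq> S \<and> S \<subseteq> V. U S)" .
  qed
qed

lemma not_cong_imp_residue_pos:
  fixes x y :: int
  assumes "p > 0" and "\<not> [x = y] (mod int p)"
  shows "nat ((x - y) mod int p) > 0"
proof -
  have "(x - y) mod int p \<noteq> 0"
    using assms(2) by (simp add: cong_iff_dvd_diff dvd_eq_mod_eq_0)
  moreover have "(x - y) mod int p \<ge> 0" using assms(1) by simp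
  ultimately show ?thesis by linarith
qed

text \<open>The factor \<open>t + 1\<close> counts the \<open>t\<close> levels of index sets below
  size \<open>t\<close> and the common points, each costing at most \<open>p * m ^ (t - 1)\<close>
  points.\<close>

lemma exists_alpha_intersecting_family:
  assumes p: "prime p" and t: "t \<ge> 1" and m: "m > t"
    and at: "\<not> [a t = a (t + 1)] (mod int p)"
    and tail: "\<forall>i\<in>{t+1..k}. [a i = a (t + 1)] (mod int p)"
    and n: "nat ((a t - a (t + 1)) mod int p) * (m choose t) + p * (t + 1) * m ^ (t - 1) \<le> n"
  obtains F where "F \<in> alpha_families p k a n" "card F = m"
proof -
  define V where "V = {..<m}"
  define w where "w = nat ((a t - a (t + 1)) mod int p)"
  define b where "b = nat (a (t + 1) mod int p)"
  have V: "finite V" "card V = m" by (auto simp: V_def)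
  have p0: "p > 0" using p prime_gt_0_nat by blast
  have int_w: "int w = (a t - a (t + 1)) mod int p" and int_b: "int b = a (t + 1) mod int p"
    using p0 by (simp_all add: w_def b_def)
  have "b < p" using p0 by (simp add: b_def nat_less_iff)
  have w0: "w > 0" unfolding w_def by (rule not_cong_imp_residue_pos[OF p0 at])
  \<comment> \<open>The targets are shifted by \<open>a (t + 1)\<close>, the residue that the
    \<open>b\<close> common points add to every intersection.\<close>
  obtain W where Wp: "\<And>S. W S < p" and W: "\<And>I. I \<subseteq> V \<Longrightarrow> card I \<le> t \<Longrightarrow>
      [int (\<Sum>S | I \<subseteq> S \<and> S \<subseteq> V \<and> card S \<le> t. W S) = a (card I) - a (t + 1)] (mod int p)"
    using exists_weights_mod[OF V(1) p0, of 0 t "\<lambda>i. a i - a (t + 1)"] by auto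
  have fin: "finite {S. P S \<and> S \<subseteq> V \<and> Q S}" for P Q
    by (rule finite_subset[of _ "Pow V"]) (use V in auto)
  \<comment> \<open>A \<open>t\<close>-subset has no proper superset of size at most
    \<open>t\<close>, so its sum is its own weight. The exact value \<open>w\<close>, not just its
    residue, gives the leading constant.\<close>
  have Wt: "W S = w" if S: "S \<subseteq> V" "card S = t" for S
  proof -
    have "{S'. S \<subseteq> S' \<and> S' \<subseteq> V \<and> card S' \<le> t} = {S}"
      using S V(1) by (auto dest: card_seteq[rotated] intro: finite_subset)
    hence "[int (W S) = int w] (mod int p)"
      using W[of S] S by (simp add: int_w unique_euclidean_semiring_class.cong_def)
    moreover have "w < p" using p0 by (simp add: w_def nat_less_iff)
    ultimately show ?thesis using Wp[of S] cong_less_modulus_unique_nat cong_int_iff by blast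
  qed
  define U where "U S = (if card S \<le> t then W S else 0) + (if S = V then b else 0)" for S
  have sumU: "(\<Sum>S | I \<subseteq> S \<and> S \<subseteq> V. U S) = (\<Sum>S | I \<subseteq> S \<and> S \<subseteq> V \<and> card S \<le> t. W S) + b"
    if I: "I \<subseteq> V" for I
  proof -
    have f: "finite {S. I \<subseteq> S \<and> S \<subseteq> V}" using fin[of "\<lambda>S. I \<subseteq> S" "\<lambda>_. True"] by simp
    have "{S \<in> {S. I \<subseteq> S \<and> S \<subseteq> V}. card S \<le> t} = {S. I \<subseteq> S \<and> S \<subseteq> V \<and> card S \<le> t}" by auto
    thus ?thesis using I f
      by (simp add: U_def sum.distrib flip: sum.inter_filter)
  qed
  \<comment> \<open>The total is the sum over the supersets of the empty set; it is then split by
    cardinality.\<close>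
  have "(\<Sum>S\<in>Pow V. U S) = (\<Sum>S | S \<subseteq> V \<and> card S \<le> t. W S) + b"
    using sumU[of "{}"] by (simp add: Pow_def)
  also have "(\<Sum>S | S \<subseteq> V \<and> card S \<le> t. W S) = (\<Sum>j\<le>t. \<Sum>S | S \<subseteq> V \<and> card S = j. W S)"
    (is "sum W ?A = _")
  proof -
    have "sum W ?A = (\<Sum>j\<le>t. \<Sum>S | S \<in> ?A \<and> card S = j. W S)"
      using V(1) by (intro sum.group[symmetric]) auto
    also have "\<dots> = (\<Sum>j\<le>t. \<Sum>S | S \<subseteq> V \<and> card S = j. W S)"
      by (intro sum.cong) auto
    finally show ?thesis .
  qed
  also have "\<dots> = (\<Sum>j<t. \<Sum>S | S \<subseteq> V \<and> card S = j. W S) + w * (m choose t)"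
    using Wt by (simp add: lessThan_Suc_atMost[symmetric] n_subsets V)
  also have "(\<Sum>j<t. \<Sum>S | S \<subseteq> V \<and> card S = j. W S) \<le> (\<Sum>j<t. p * m ^ (t - 1))"
  proof (rule sum_mono)
    fix j assume j: "j \<in> {..<t}"
    have "(\<Sum>S | S \<subseteq> V \<and> card S = j. W S) \<le> (\<Sum>S | S \<subseteq> V \<and> card S = j. p)"
      by (intro sum_mono less_imp_le Wp)
    also have "\<dots> = (m choose j) * p" by (simp add: n_subsets V)
    also have "(m choose j) \<le> m ^ j" using j m by (intro binomial_le_pow) auto
    also have "m ^ j \<le> m ^ (t - 1)" using j m by (intro power_increasing) auto
    finally show "(\<Sum>S | S \<subseteq> V \<and> card S = j. W S) \<le> p * m ^ (t - 1)" by (simp add: mult.commute)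
  qed
  also have "b \<le> p * m ^ (t - 1)" using \<open>b < p\<close> m by (simp add: order_trans[of b p])
  finally have "(\<Sum>S\<in>Pow V. U S) \<le> p * (t + 1) * m ^ (t - 1) + w * (m choose t)"
    by (simp add: algebra_simps)
  hence total: "(\<Sum>S\<in>Pow V. U S) \<le> n" using n by (simp add: w_def add.commute)
  obtain A where Asub: "\<And>v. v \<in> V \<Longrightarrow> A v \<subseteq> {1..n}"
    and A: "\<And>I. I \<subseteq> V \<Longrightarrow> I \<noteq> {} \<Longrightarrow> card (\<Inter>v\<in>I. A v) = (\<Sum>S | I \<subseteq> S \<and> S \<subseteq> V. U S)"
    using realize_intersection_weights[OF V(1) total] by blast
  \<comment> \<open>As \<open>m > t\<close>, some \<open>t\<close>-subset contains \<open>x\<close>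
    but not \<open>y\<close>; its \<open>w > 0\<close> points lie in \<open>A x\<close> and outside
    \<open>A y\<close>.\<close>
  have inj: "inj_on A V"
  proof (rule inj_onI, rule ccontr)
    fix x y assume xy: "x \<in> V" "y \<in> V" "A x = A y" "x \<noteq> y"
    have "t - 1 \<le> card (V - {x, y})" using m xy V by (simp add: card_Diff_subset)
    then obtain S where S: "S \<subseteq> V - {x, y}" "card S = t - 1"
      using obtain_subset_with_card_n by metis
    have "finite S" using S V(1) by (meson finite_Diff finite_subset)
    hence ct: "card (insert x S) = t" using S t by (subst card_insert_disjoint) auto
    have "(\<Sum>S | {x, y} \<subseteq> S \<and> S \<subseteq> V. U S) < (\<Sum>S | {x} \<subseteq> S \<and> S \<subseteq> V. U S)"
    proof (rule sum_strict_mono2[where b = "insert x S"])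
      show "finite {S. {x} \<subseteq> S \<and> S \<subseteq> V}" using fin[of "\<lambda>S. {x} \<subseteq> S" "\<lambda>_. True"] by simp
      show "0 < U (insert x S)" using ct Wt[of "insert x S"] S(1) xy(1) w0
        by (simp add: U_def subset_Diff_insert)
    qed (use S xy in auto)
    thus False using A[of "{x}"] A[of "{x, y}"] xy by simp
  qed
  have "alpha_intersecting p k a (A ` V)"
    unfolding alpha_intersecting_def
  proof (intro ballI allI impI)
    fix i G assume i: "i \<in> {1..k}" and "G \<subseteq> A ` V \<and> card G = i"
    then obtain I where I: "I \<subseteq> V" "G = A ` I" "card G = i" by (auto simp: subset_image_iff)
    have cI: "card I = i" using I inj by (metis card_image inj_on_subset)
    have "int (card (\<Inter>G)) = int (\<Sum>S | I \<subseteq> S \<and> S \<subseteq> V \<and> card S \<le> t. W S) + int b"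
    proof -
      have "I \<noteq> {}" using cI i by auto
      thus ?thesis unfolding I(2) A[OF I(1) \<open>I \<noteq> {}\<close>] sumU[OF I(1)] by simp
    qed
    also have "[\<dots> = a i] (mod int p)"
    proof (cases "i \<le> t")
      case True
      have "[int (\<Sum>S | I \<subseteq> S \<and> S \<subseteq> V \<and> card S \<le> t. W S) + int b
          = (a i - a (t + 1)) + a (t + 1)] (mod int p)"
        using W[OF I(1)] True cI int_b by (intro cong_add) (auto simp: unique_euclidean_semiring_class.cong_def)
      thus ?thesis by simp
    next
      case False
      \<comment> \<open>Beyond \<open>t\<close> members only the common points survive.\<close>
      have "\<not> card S \<le> t" if "I \<subseteq> S" "S \<subseteq> V" for S
        using card_mono[OF finite_subset[OF that(2) V(1)] that(1)] False cI by simp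
      hence "{S. I \<subseteq> S \<and> S \<subseteq> V \<and> card S \<le> t} = {}" by blast
      hence "[int (\<Sum>S | I \<subseteq> S \<and> S \<subseteq> V \<and> card S \<le> t. W S) + int b = a (t + 1)] (mod int p)"
        by (simp only: sum.empty int_b unique_euclidean_semiring_class.cong_def of_nat_0 add_0 mod_mod_trivial)
      moreover have "[a i = a (t + 1)] (mod int p)" using tail False i by auto
      ultimately show ?thesis by (meson cong_sym cong_trans)
    qed
    finally show "[int (card (\<Inter>G)) = a i] (mod int p)" .
  qed
  hence "A ` V \<in> alpha_families p k a n" using Asub by (auto simp: alpha_families_def)
  thus ?thesis using that card_image[OF inj] V by auto
qed

section \<open>Explicit bounds for the maximum\<close>

text \<open>Each of the \<open>t\<close> factors of \<open>fact t * (M choose t)\<close> is at least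
  \<open>M - t\<close>; taking \<open>t\<close>-th roots costs only the additive constant
  \<open>t\<close>.\<close>

lemma max_alpha_family_upper:
  assumes "prime p" "t \<ge> 1" "k \<ge> 2 * t" "\<not> [a t = a (t + 1)] (mod int p)"
    and "\<forall>i\<in>{t+1..k}. [a i = a (t + 1)] (mod int p)"
  shows "real (max_alpha_family p k a n) \<le> t + (fact t * (real n + 1)) powr (1 / real t)"
proof -
  define M where "M = max_alpha_family p k a n"
  have "M \<in> card ` alpha_families p k a n"
    unfolding M_def max_alpha_family_def
    using finite_alpha_families empty_in_alpha_families by (intro Max_in) blast+
  hence "(M choose t) \<le> n + 1"
    using alpha_intersecting_choose_bound[OF assms] by auto
  hence C: "real (M choose t) \<le> real n + 1" by linarith
  show ?thesis
  proof (cases "t \<le> M")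
    case True
    have "real (M - t) ^ t = (\<Prod>i = 0..<t. real (M - t))" by simp
    also have "\<dots> \<le> (\<Prod>i = 0..<t. real M - real i)"
      using True by (intro prod_mono) auto
    also have "\<dots> = fact t * real (M choose t)"
      by (simp add: binomial_gbinomial gbinomial_mult_fact)
    also have "\<dots> \<le> fact t * (real n + 1)"
      using C by (intro mult_left_mono) auto
    finally have "real (M - t) ^ t \<le> fact t * (real n + 1)" .
    hence "(real (M - t) ^ t) powr (1 / t) \<le> (fact t * (real n + 1)) powr (1 / t)"
      by (intro powr_mono2) auto
    \<comment> \<open>\<open>M = t\<close> is treated apart because \<open>powr_realpow\<close>
      requires a positive base.\<close>
    moreover have "(real (M - t) ^ t) powr (1 / t) = real (M - t)"
      using \<open>t \<ge> 1\<close> True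
      by (cases "M = t") (auto simp: powr_realpow[symmetric] powr_powr simp del: of_nat_diff)
    ultimately show ?thesis using True by (simp add: M_def)
  next
    case False
    thus ?thesis by (simp add: M_def add_increasing2)
  qed
qed

text \<open>The root solves \<open>w * x ^ t / fact t = n\<close>, where the left side is the
  leading term of the number of points used; a family size a constant below it leaves room for the
  rest.\<close>

lemma max_alpha_family_lower:
  assumes "prime p" and t: "t \<ge> 1" and at: "\<not> [a t = a (t + 1)] (mod int p)"
    and "\<forall>i\<in>{t+1..k}. [a i = a (t + 1)] (mod int p)"
  defines "w \<equiv> nat ((a t - a (t + 1)) mod int p)"
  shows "(fact t * real n / w) powr (1 / real t) - (p * (t + 1) * fact t + t + 1)
    \<le> real (max_alpha_family p k a n)"
proof -
  \<comment> \<open>With this \<open>D\<close>, the term \<open>t * D * m ^ (t - 1)\<close> of \<open>(m + D) ^ t\<close> absorbs the lower order points.\<close>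
  define D where "D = p * (t + 1) * fact t"
  define x where "x = (fact t * real n / w) powr (1 / real t)"
  define m where "m = nat \<lfloor>x\<rfloor> - D"
  have p0: "p > 0" using \<open>prime p\<close> prime_gt_0_nat by blast
  have w0: "w > 0" unfolding w_def by (rule not_cong_imp_residue_pos[OF p0 at])
  \<comment> \<open>This also holds if the subtraction in \<open>m\<close> truncates to 0. For
    \<open>m \<le> t\<close> it makes the claimed lower bound negative.\<close>
  have xm: "x - (D + t + 1) < real m - t"
    unfolding m_def by linarith
  show ?thesis
  proof (cases "m > t")
    case True
    have "real (m + D) \<le> x" using True unfolding m_def by linarith
    hence "real (m + D) ^ t \<le> x ^ t" by (intro power_mono) auto
    also have "x ^ t = fact t * real n / w"
    proof (cases "n = 0")
      case False
      thus ?thesis using t w0 by (simp add: x_def powr_realpow[symmetric] powr_powr)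
    qed (use t in \<open>simp add: x_def\<close>)
    finally have le: "w * real (m + D) ^ t \<le> fact t * real n"
      using w0 by (simp add: field_simps)
    have "real m ^ t + t * D * real m ^ (t - 1) \<le> real (m + D) ^ t"
    proof -
      have "m ^ t + t * D * m ^ (t - 1) \<le> (m + D) ^ t"
      proof -
        \<comment> \<open>Only the two top powers of \<open>m\<close> in the binomial expansion are
          kept.\<close>
        have "(\<Sum>k\<in>{t - 1, t}. (t choose k) * m ^ k * D ^ (t - k)) \<le> (m + D) ^ t"
          unfolding binomial of_nat_id by (rule sum_mono2) auto
        moreover have "t choose (t - 1) = t" using t binomial_symmetric[of 1 t] by simp
        ultimately show ?thesis using t by (simp add: algebra_simps)
      qed
      thus ?thesis by (metis of_nat_add of_nat_le_iff of_nat_mult of_nat_power)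
    qed
    hence "w * (real m ^ t + t * D * real m ^ (t - 1)) \<le> fact t * real n"
      using le by (meson mult_left_mono of_nat_0_le_iff order_trans)
    moreover have "real D \<le> w * (t * D)"
    proof -
      have "1 \<le> w * t" using w0 t by simp
      hence "real D * 1 \<le> real D * real (w * t)" by (intro mult_left_mono) linarith+
      thus ?thesis by (simp add: mult_ac)
    qed
    hence "D * real m ^ (t - 1) \<le> w * (t * D) * real m ^ (t - 1)"
      by (rule mult_right_mono) simp
    ultimately have "w * real m ^ t + D * real m ^ (t - 1) \<le> fact t * real n"
      by (simp add: algebra_simps)
    moreover have "fact t * real (m choose t) \<le> real m ^ t"
    proof -
      have "real ((m choose t) * fact t) \<le> real (m ^ t)"
        using binomial_fact_pow by (simp only: of_nat_le_iff)
      thus ?thesis by (simp add: mult.commute)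
    qed
    hence "w * (fact t * real (m choose t)) \<le> w * real m ^ t" by (intro mult_left_mono) auto
    ultimately have "fact t * real (w * (m choose t) + p * (t + 1) * m ^ (t - 1)) \<le> fact t * real n"
      by (simp add: D_def algebra_simps)
    hence "w * (m choose t) + p * (t + 1) * m ^ (t - 1) \<le> n"
      by (simp only: mult_le_cancel_left_pos[OF fact_gt_zero] of_nat_le_iff)
    then obtain F where "F \<in> alpha_families p k a n" "card F = m"
      using exists_alpha_intersecting_family[OF assms(1,2) True assms(3,4)] unfolding w_def by blast
    hence "m \<le> max_alpha_family p k a n"
      unfolding max_alpha_family_def using finite_alpha_families by (intro Max_ge) auto
    thus ?thesis using xm by (simp add: x_def D_def)
  next
    case False
    thus ?thesis using xm by (simp add: x_def D_def)
  qed
qed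

section \<open>Asymptotics from the explicit bounds\<close>

theorem theoremA2:
  fixes p t k :: nat and a :: "nat \<Rightarrow> int"
  assumes "prime p"
    and "t \<ge> 1"
    and "k \<ge> 2 * t"
    and "\<not> [a t = a (t + 1)] (mod int p)"
    and "\<forall>i\<in>{t+1..k}. [a i = a (t + 1)] (mod int p)"
  shows "(\<lambda>n. real (max_alpha_family p k a n)) \<in> \<Theta>(\<lambda>n. real n powr (1 / real t)) \<and>
    ([a t - a (t + 1) = 1] (mod int p) \<longrightarrow>
      asymp_equiv (\<lambda>n. real (max_alpha_family p k a n)) sequentially
        (\<lambda>n. (fact t * real n) powr (1 / real t)))"
proof -
  define f where "f n = real (max_alpha_family p k a n)" for n
  define w where "w = nat ((a t - a (t + 1)) mod int p)"
  define C where "C = real (p * (t + 1) * fact t + t + 1)"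
  define e where "e = 1 / real t"
  define T where "T = (fact t :: real)"
  have pos: "e > 0" "T > 0" using assms(2) by (auto simp: e_def T_def)
  have p0: "p > 0" using \<open>prime p\<close> prime_gt_0_nat by blast
  have w0: "real w > 0" using not_cong_imp_residue_pos[OF p0 assms(4)] by (simp add: w_def)
  have upper: "f n \<le> t + (T * (real n + 1)) powr e" for n
    using max_alpha_family_upper[OF assms, of n] by (simp add: f_def e_def T_def)
  have lower: "(T * real n / w) powr e - C \<le> f n" for n
    using max_alpha_family_lower[OF assms(1,2,4,5), of n] by (simp add: f_def e_def T_def C_def w_def)
  have "f \<in> O(\<lambda>n. real n powr e)"
  proof -
    have "f \<in> O(\<lambda>n. t + (T * (real n + 1)) powr e)"
      using upper by (intro landau_o.big_mono always_eventually) (auto simp: f_def intro: order_trans)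
    also have "(\<lambda>n. t + (T * (real n + 1)) powr e) \<in> O(\<lambda>n. real n powr e)"
      using pos by real_asymp
    finally show ?thesis .
  qed
  moreover have "(\<lambda>n. real n powr e) \<in> O(f)"
  proof -
    have "(\<lambda>n. real n powr e) \<in> O(\<lambda>n. (T * real n / w) powr e - C)"
      using pos w0 by real_asymp
    also have "(\<lambda>n. (T * real n / w) powr e - C) \<in> O(f)"
    proof -
      \<comment> \<open>\<open>O\<close> compares absolute values, so the lower bound must first
        become nonnegative.\<close>
      have "eventually (\<lambda>n. (T * real n / w) powr e - C \<ge> 0) sequentially"
        using pos w0 by real_asymp
      thus ?thesis using lower
        by (intro landau_o.big_mono) (auto elim!: eventually_mono simp: f_def)
    qed
    finally show ?thesis .
  qed
  moreover have "asymp_equiv f sequentially (\<lambda>n. (T * real n) powr e)"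
    if "[a t - a (t + 1) = 1] (mod int p)"
  proof (rule asymp_equiv_sandwich_real)
    \<comment> \<open>With \<open>w = 1\<close> both bounds have the same leading term.\<close>
    have "w = 1" using that prime_gt_1_nat[OF assms(1)] by (simp add: w_def unique_euclidean_semiring_class.cong_def)
    show "(\<lambda>n. (T * real n / w) powr e - C) \<sim>[sequentially] (\<lambda>n. (T * real n) powr e)"
      using pos unfolding \<open>w = 1\<close> by real_asymp
    show "(\<lambda>n. t + (T * (real n + 1)) powr e) \<sim>[sequentially] (\<lambda>n. (T * real n) powr e)"
      using pos by real_asymp
    show "eventually (\<lambda>n. f n \<in> {(T * real n / w) powr e - C..t + (T * (real n + 1)) powr e}) sequentially"
      using lower upper by simp
  qed
  ultimately show ?thesis unfolding f_def[abs_def] e_def T_def by (auto simp: bigtheta_def bigomega_iff_bigo)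
qed

end
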